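(* Let $\mathcal N=(\mathcal V,\mathcal E,C)$ be a network with $|\mathcal E_v^+|\le 3$ for all $v\in\mathcal V\setminus\{n\}$ such that $(\mathcal V\setminus\{n\},\mathcal E\setminus\mathcal E_n^-)$ is a directed tree (i.e., its underlying undirected graph is a tree). Let $\lambda>0$ be a constant inflow at the origin node, and let the routing policy be a BPA routing policy that is flow monotone over $\mathcal N$. Then the associated network flow dynamics is transferring for every disturbance process $(\delta(t))_{t\ge1}$ with $\mathcal D(\delta)<S^*(\mathcal N,\lambda)$, where $S^*(\mathcal N,\lambda):=S(\mathcal E_0^+,\mathbf 0,\lambda)$ is the quantity computed by the Backward Propagation Algorithm.
   Context: **Network.** A network $\mathcal N=(\mathcal V,\mathcal E,C)$ is a finite directed multigraph (parallel links allowed) with node set $\mathcal V=\{0,1,\dots,n\}$, link multiset $\mathcal E$, and capacities $C\in\mathbb R^{\mathcal E}$, $C_e>0$. Link $e$ goes from $\sigma_e$ (tail) to $\tau_e$ (head). $\mathcal E_v^+=\{e:\sigma_e=v\}$, $\mathcal E_v^-=\{e:\tau_e=v\}$. Node $0$ is the unique origin (only node without incoming links), node $n$ the unique destination (only node without outgoing links); every other node lies on a directed path from $0$ to $n$. The external inflow is $\lambda_0=\lambda>0$ at node $0$ and $\lambda_v=0$ at $v\neq 0$. For acyclic networks, nodes are numbered in a topological order (every link goes from a smaller to a larger number). **Distributed (oblivious) routing policy.** A family $\mathcal G$ of functions $G^v(\mathcal J,\cdot):\mathbb R_+\to\mathbb R_+^{\mathcal J}$, for $v\in\mathcal V\setminus\{n\}$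 and $\emptyset\ne\mathcal J\subseteq\mathcal E_v^+$, such that for every $\mu\ge0$: $\sum_{e\in\mathcal J}G^v_e(\mathcal J,\mu)=\mu$, and, for all nonempty $\mathcal K\subseteq\mathcal J\subseteq\mathcal E_v^+$, $G^v_e(\mathcal J,\mu)\le G^v_e(\mathcal K,\mu)$ for all $e\in\mathcal K$ (link monotonicity). **Flow monotonicity.** A distributed routing policy is flow monotone at $v\in\mathcal V\setminus\{n\}$ if for every nonempty $\mathcal J\subseteq\mathcal E_v^+$ and $0\le\mu_1\le\mu_2$ one has $G^v(\mathcal J,\mu_1)\le G^v(\mathcal J,\mu_2)$ componentwise. It is flow monotone over $\mathcal N$ if it is flow monotone at every $v\in\mathcal V\setminus\{0,n\}$. **Dynamics.** The state at time $t=0,1,2,\dots$ is $(\mathcal V(t),\mathcal E(t),f(t),C(t))$: active non-destination nodes, active links, link flows, residual capacities. Initially $\mathcal V(0)=\mathcal V\setminus\{n\}$, $\mathcal E(0)=\mathcal E$, $C(0)=C$, and $f(0)\in\mathbb R_+^{\mathcal E}$ is a feasible equilibrium flow ($f_e(0)<C_e$ for all $e$, and $\lambda_v+\sum_{e\in\mathcal E_v^-}f_e(0)=\sum_{e\in\mathcal E_v^+}f_e(0)$ for all $v\ne n$) that is consistent with the routing policy: $f_e(0)=G^v_e(\mathcal E_v^+,\lambda_v(0))$ for $e\in\mathcal E_v^+$, $v\neq n$ (this is a standing assumption on $\mathcal G$ and $\lambda$). With $\mathcal E_v^{\pm}(t)=\mathcal E_v^{\pm}\cap\mathcal E(t)$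 and $\lambda_v(t)=\lambda_v+\sum_{e\in\mathcal E_v^-(t)}f_e(t)$, the state evolves by - $\mathcal E(t+1)=\mathcal E(t)\setminus\{e\in\mathcal E(t): f_e(t)\ge C_e(t)\}\setminus\{e\in\mathcal E(t):\tau_e\notin\mathcal V(t)\cup\{n\}\}$; - $\mathcal V(t+1)=\mathcal V(t)\setminus\{v\in\mathcal V(t):\mathcal E_v^+(t)=\emptyset\}$; - $f_e(t+1)=G^v_e(\mathcal E_v^+(t),\lambda_v(t))$ for $v\in\mathcal V(t)$, $e\in\mathcal E_v^+(t)$, and $f_e(t+1)=0$ for all other links; - $C_e(t+1)=C_e(t)-\delta_e(t+1)$. A disturbance process is a sequence $(\delta(t))_{t\ge1}$ in $\mathbb R_+^{\mathcal E}$ with $\sum_{1\le s\le t}\delta(s)\le C$ componentwise for all $t\ge 1$. Its magnitude is $\mathcal D(\delta)=\sum_{e\in\mathcal E}\sum_{t\ge1}\delta_e(t)$. The dynamics is *transferring* if $\lim_{t\to\infty}\sum_{e\in\mathcal E_n^-}f_e(t)=\lambda$. **Backward Propagation Algorithm (BPA).** For $v\neq n$, $\emptyset\ne\mathcal J\subseteq\mathcal E_v^+$, $\mu\ge0$ and a nonnegative vector $r$ whose index set contains $\mathcal J$, let $$\mathcal X_v(\mathcal J,r,\mu)=\{x\in\mathbb R_+^{\mathcal J}: r_e\le x_e\le C_e\ \forall e\in\mathcal J,\ \sum_{e\in\mathcal J}x_e=\mu\}.$$ Define functions $S$ recursively for $v=n-1,n-2,\dots,0$. Put $R_n(\mu)=+\infty$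 and $R_w(\mu)=S(\mathcal E_w^+,\mathbf 0,\mu)$ for $w\ne n$. For $e\in\mathcal E_v^+$ let $S_e(\mu)=\min\{C_e-\mu,\,R_{\tau_e}(\mu)\}$ if $\mu\le C_e$ and $S_e(\mu)=0$ if $\mu>C_e$. Set $S(\emptyset,r,\mu)=0$ and $S(\{e\},r,\mu)=S_e(\mu)$; for $|\mathcal J|\ge2$, $S(\mathcal J,r,\mu)=0$ if $\mathcal X_v(\mathcal J,r,\mu)=\emptyset$, and otherwise $$S(\mathcal J,r,\mu)=\max_{x\in\mathcal X_v(\mathcal J,r,\mu)}\ \min_{e\in\mathcal J}\big(S_e(x_e)+S(\mathcal J\setminus\{e\},x,\mu)\big).$$ Let $g(\mathcal J,r,\mu)=\operatorname{argmax}_{x\in\mathcal X_v(\mathcal J,r,\mu)}\min_{e\in\mathcal J}\big(S_e(x_e)+S(\mathcal J\setminus\{e\},x,\mu)\big)$ be the set of maximizers (empty if $\mathcal X_v(\mathcal J,r,\mu)=\emptyset$). **BPA routing.** A BPA routing policy is a distributed routing policy such that for all $v\in\mathcal V\setminus\{n\}$ and $\mu\ge0$: $r^*:=G^v(\mathcal E_v^+,\mu)\in g(\mathcal E_v^+,\mathbf 0,\mu)$ and $G^v(\mathcal J,\mu)\in g(\mathcal J,r^*,\mu)$ for all nonempty $\mathcal J\subsetneq\mathcal E_v^+$. Each of these membership conditions is imposed only when the corresponding feasible set $\mathcal X_v$ is nonempty. *)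

theory Defs
  imports Complex_Main "Graph_Theory.Digraph_Component"
begin

section \<open>Trees\<close>

text \<open>
  The digraphs of the library are directed multigraphs, with arbitrary arc names. Its predicate
  \<open>tree\<close> excludes only directed cycles, so it also holds, for instance, for an acyclic orientation
  of a triangle. Here the underlying undirected multigraph has to be a tree, in which a loop and a
  pair of parallel or antiparallel arcs are cycles (of length 1 and 2).

  \<open>undirected_cycle G vs es\<close>: the arc \<open>es ! i\<close> joins, in either direction, the node \<open>vs ! i\<close> and its
  cyclic successor.
\<close>

definition undirected_cycle :: "('v, 'e) pre_digraph \<Rightarrow> 'v list \<Rightarrow> 'e list \<Rightarrow> bool" where
  "undirected_cycle G vs es \<longleftrightarrow>
     es \<noteq> [] \<and> length vs = length es \<and> distinct vs \<and> distinct es \<and>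
     set vs \<subseteq> verts G \<and> set es \<subseteq> arcs G \<and>
     (\<forall>i < length es.
        {tail G (es ! i), head G (es ! i)} = {vs ! i, vs ! (Suc i mod length vs)})"

definition directed_tree :: "('v, 'e) pre_digraph \<Rightarrow> bool" where
  "directed_tree G \<longleftrightarrow>
     Digraph_Component.connected G \<and> (\<nexists>vs es. undirected_cycle G vs es)"


section \<open>Networks\<close>

text \<open>
  A routing policy \<open>P\<close> is applied as \<open>P v J \<mu> e\<close>; only the values for \<open>e \<in> J\<close> are meaningful.
  In the same way a vector indexed by a set \<open>J\<close> of links is a function on all links of which
  only the values on \<open>J\<close> matter.
\<close>

type_synonym 'e routing = "nat \<Rightarrow> 'e set \<Rightarrow> real \<Rightarrow> 'e \<Rightarrow> real"

record 'e net_state =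
  act_nodes :: "nat set"
  act_links :: "'e set"
  flow :: "'e \<Rightarrow> real"
  resid :: "'e \<Rightarrow> real"

locale network = fin_digraph G
  for G :: "(nat, 'e) pre_digraph" +
  fixes n :: nat and C :: "'e \<Rightarrow> real"
  assumes nodes: "verts G = {0..n}"
    and capacity_pos: "e \<in> arcs G \<Longrightarrow> 0 < C e"
    and unique_origin: "v \<in> verts G \<Longrightarrow> in_arcs G v = {} \<longleftrightarrow> v = 0"
    and unique_destination: "v \<in> verts G \<Longrightarrow> out_arcs G v = {} \<longleftrightarrow> v = n"
    and on_path: "v \<in> verts G \<Longrightarrow> v \<noteq> 0 \<Longrightarrow> v \<noteq> n \<Longrightarrow>
      \<exists>p. apath 0 p n \<and> v \<in> set (awalk_verts 0 p)"
begin

definition without_destination :: "(nat, 'e) pre_digraph" where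
  "without_destination = G\<lparr>verts := verts G - {n}, arcs := arcs G - in_arcs G n\<rparr>"

definition routing_policy :: "'e routing \<Rightarrow> bool" where
  "routing_policy P \<longleftrightarrow>
     (\<forall>v \<in> verts G - {n}. \<forall>J. J \<noteq> {} \<and> J \<subseteq> out_arcs G v \<longrightarrow>
        (\<forall>\<mu> \<ge> 0.
           (\<forall>e \<in> J. 0 \<le> P v J \<mu> e) \<and>
           (\<Sum>e\<in>J. P v J \<mu> e) = \<mu> \<and>
           (\<forall>K. K \<noteq> {} \<and> K \<subseteq> J \<longrightarrow> (\<forall>e \<in> K. P v J \<mu> e \<le> P v K \<mu> e))))"

definition flow_monotone_at :: "'e routing \<Rightarrow> nat \<Rightarrow> bool" where
  "flow_monotone_at P v \<longleftrightarrow>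
     (\<forall>J. J \<noteq> {} \<and> J \<subseteq> out_arcs G v \<longrightarrow>
        (\<forall>\<mu>1 \<mu>2. 0 \<le> \<mu>1 \<and> \<mu>1 \<le> \<mu>2 \<longrightarrow> (\<forall>e \<in> J. P v J \<mu>1 e \<le> P v J \<mu>2 e)))"

definition flow_monotone :: "'e routing \<Rightarrow> bool" where
  "flow_monotone P \<longleftrightarrow> (\<forall>v \<in> verts G - {0, n}. flow_monotone_at P v)"

subsection \<open>Dynamics\<close>

definition node_inflow :: "real \<Rightarrow> 'e set \<Rightarrow> ('e \<Rightarrow> real) \<Rightarrow> nat \<Rightarrow> real" where
  "node_inflow lam A f v = (if v = 0 then lam else 0) + (\<Sum>e \<in> in_arcs G v \<inter> A. f e)"

definition equilibrium_flow :: "real \<Rightarrow> ('e \<Rightarrow> real) \<Rightarrow> bool" where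
  "equilibrium_flow lam f \<longleftrightarrow>
     (\<forall>e \<in> arcs G. 0 \<le> f e \<and> f e < C e) \<and>
     (\<forall>v \<in> verts G - {n}. node_inflow lam (arcs G) f v = (\<Sum>e \<in> out_arcs G v. f e))"

definition consistent_flow :: "'e routing \<Rightarrow> real \<Rightarrow> ('e \<Rightarrow> real) \<Rightarrow> bool" where
  "consistent_flow P lam f \<longleftrightarrow>
     (\<forall>v \<in> verts G - {n}. \<forall>e \<in> out_arcs G v.
        f e = P v (out_arcs G v) (node_inflow lam (arcs G) f v) e)"

text \<open>
  The disturbances \<open>\<delta> t\<close> are indexed by \<open>t \<ge> 1\<close>; the value \<open>\<delta> 0\<close> is never used.
\<close>

primrec net_dynamics ::
  "'e routing \<Rightarrow> real \<Rightarrow> ('e \<Rightarrow> real) \<Rightarrow> (nat \<Rightarrow> 'e \<Rightarrow> real) \<Rightarrow> nat \<Rightarrow> 'e net_state"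
where
  "net_dynamics P lam f0 \<delta> 0 =
     \<lparr>act_nodes = verts G - {n}, act_links = arcs G, flow = f0, resid = C\<rparr>"
| "net_dynamics P lam f0 \<delta> (Suc t) =
     (let s = net_dynamics P lam f0 \<delta> t in
      \<lparr>act_nodes = act_nodes s - {v \<in> act_nodes s. out_arcs G v \<inter> act_links s = {}},
       act_links = act_links s - {e \<in> act_links s. flow s e \<ge> resid s e}
                               - {e \<in> act_links s. head G e \<notin> act_nodes s \<union> {n}},
       flow = (\<lambda>e. if tail G e \<in> act_nodes s \<and> e \<in> act_links s
                   then P (tail G e) (out_arcs G (tail G e) \<inter> act_links s)
                          (node_inflow lam (act_links s) (flow s) (tail G e)) e
                   else 0),
       resid = (\<lambda>e. resid s e - \<delta> (Suc t) e)\<rparr>)"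

definition transferring ::
  "'e routing \<Rightarrow> real \<Rightarrow> ('e \<Rightarrow> real) \<Rightarrow> (nat \<Rightarrow> 'e \<Rightarrow> real) \<Rightarrow> bool"
where
  "transferring P lam f0 \<delta> \<longleftrightarrow>
     (\<lambda>t. \<Sum>e \<in> in_arcs G n. flow (net_dynamics P lam f0 \<delta> t) e) \<longlonglongrightarrow> lam"

definition disturbance :: "(nat \<Rightarrow> 'e \<Rightarrow> real) \<Rightarrow> bool" where
  "disturbance \<delta> \<longleftrightarrow>
     (\<forall>t \<ge> 1. \<forall>e \<in> arcs G. 0 \<le> \<delta> t e \<and> (\<Sum>s = 1..t. \<delta> s e) \<le> C e)"

text \<open>
  For a disturbance process the inner series have nonnegative terms and bounded partial sums,
  hence they are summable.
\<close>

definition magnitude :: "(nat \<Rightarrow> 'e \<Rightarrow> real) \<Rightarrow> real" where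
  "magnitude \<delta> = (\<Sum>e \<in> arcs G. \<Sum>t. \<delta> (Suc t) e)"

end


section \<open>The Backward Propagation Algorithm\<close>

definition feasible :: "('e \<Rightarrow> real) \<Rightarrow> 'e set \<Rightarrow> ('e \<Rightarrow> real) \<Rightarrow> real \<Rightarrow> ('e \<Rightarrow> real) set" where
  "feasible C J r \<mu> =
     {x. (\<forall>e \<in> J. 0 \<le> x e \<and> r e \<le> x e \<and> x e \<le> C e) \<and> (\<Sum>e\<in>J. x e) = \<mu>}"

text \<open>
  The recursion over the subsets of the outgoing links of one node, for given functions
  \<open>F e = S\<^sub>e\<close>. It is meant for finite \<open>J\<close>, where \<open>card J = 0\<close> says \<open>J = {}\<close>. The supremum
  renders the maximum over \<open>x\<close>.
\<close>

function BPA_rec ::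
  "('e \<Rightarrow> real) \<Rightarrow> ('e \<Rightarrow> real \<Rightarrow> real) \<Rightarrow> 'e set \<Rightarrow> ('e \<Rightarrow> real) \<Rightarrow> real \<Rightarrow> real"
where
  "BPA_rec C F J r \<mu> =
     (if card J = 0 then 0
      else if card J = 1 then F (the_elem J) \<mu>
      else if feasible C J r \<mu> = {} then 0
      else (SUP x \<in> feasible C J r \<mu>. MIN e \<in> J. F e (x e) + BPA_rec C F (J - {e}) x \<mu>))"
  by pat_completeness auto
termination
  by (relation "Wellfounded.measure (\<lambda>(C, F, J, r, \<mu>). card J)")
     (auto simp: card_gt_0_iff intro: psubset_card_mono)

declare BPA_rec.simps [simp del]

lemma BPA_rec_cong [fundef_cong]:
  assumes "C = C'" "J = J'" "r = r'" "\<mu> = \<mu>'"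
    and "\<And>e x. e \<in> J' \<Longrightarrow> F e x = F' e x"
  shows "BPA_rec C F J r \<mu> = BPA_rec C' F' J' r' \<mu>'"
proof -
  have "(\<And>e x. e \<in> J \<Longrightarrow> F e x = F' e x) \<Longrightarrow> BPA_rec C F J r \<mu> = BPA_rec C F' J r \<mu>"
  proof (induction C F J r \<mu> rule: BPA_rec.induct)
    case (1 C F J r \<mu>)
    have one: "F (the_elem J) \<mu> = F' (the_elem J) \<mu>" if "card J = 1"
    proof -
      from that obtain e where "J = {e}" by (auto simp: card_1_singleton_iff)
      with 1(2) show ?thesis by simp
    qed
    have rec: "(SUP x \<in> feasible C J r \<mu>. MIN e \<in> J. F e (x e) + BPA_rec C F (J - {e}) x \<mu>) =
        (SUP x \<in> feasible C J r \<mu>. MIN e \<in> J. F' e (x e) + BPA_rec C F' (J - {e}) x \<mu>)"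
      if "card J \<noteq> 0" "card J \<noteq> 1" "feasible C J r \<mu> \<noteq> {}"
      using that 1 by (intro SUP_cong arg_cong [where f = Min] image_cong refl) simp
    show ?case
      by (subst (1 2) BPA_rec.simps) (use one rec in presburger)
  qed
  with assms show ?thesis by simp
qed

text \<open>Nodes numbered in a topological order.\<close>

locale acyclic_network = network G n C
  for G :: "(nat, 'e) pre_digraph" and n :: nat and C :: "'e \<Rightarrow> real" +
  assumes topological: "e \<in> arcs G \<Longrightarrow> tail G e < head G e"
begin

text \<open>
  \<open>BPA_R v\<close> is the function \<open>R\<^sub>v\<close> for \<open>v \<noteq> n\<close>. Instead of \<open>R\<^sub>n = \<infinity>\<close>, the links into the
  destination are treated separately, by \<open>min (C\<^sub>e - x) \<infinity> = C\<^sub>e - x\<close>.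
\<close>

function BPA_R :: "nat \<Rightarrow> real \<Rightarrow> real" where
  "BPA_R v \<mu> =
     BPA_rec C
       (\<lambda>e x. if x \<le> C e
              then if head G e = n then C e - x else min (C e - x) (BPA_R (head G e) x)
              else 0)
       (out_arcs G v) (\<lambda>_. 0) \<mu>"
  by pat_completeness auto
termination
proof (relation "Wellfounded.measure (\<lambda>(v, \<mu>). n - v)")
  fix v e
  assume "e \<in> out_arcs G v" "head G e \<noteq> n"
  then have "v < head G e" "head G e < n"
    using topological [of e] head_in_verts [of e] nodes by auto
  then show "((head G e, x), (v, \<mu>)) \<in> Wellfounded.measure (\<lambda>(v, \<mu>). n - v)" for x \<mu> :: real
    by simp
qed auto

declare BPA_R.simps [simp del]

definition BPA_link :: "'e \<Rightarrow> real \<Rightarrow> real" where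
  "BPA_link e x =
     (if x \<le> C e
      then if head G e = n then C e - x else min (C e - x) (BPA_R (head G e) x)
      else 0)"

definition BPA_S :: "'e set \<Rightarrow> ('e \<Rightarrow> real) \<Rightarrow> real \<Rightarrow> real" where
  "BPA_S = BPA_rec C BPA_link"

lemma BPA_R_eq: "BPA_R v \<mu> = BPA_S (out_arcs G v) (\<lambda>_. 0) \<mu>"
  unfolding BPA_S_def BPA_R.simps [of v] by (rule BPA_rec_cong) (simp_all add: BPA_link_def)

lemma BPA_S_empty: "BPA_S {} r \<mu> = 0"
  and BPA_S_singleton: "BPA_S {e} r \<mu> = BPA_link e \<mu>"
  and BPA_S_infeasible: "2 \<le> card J \<Longrightarrow> feasible C J r \<mu> = {} \<Longrightarrow> BPA_S J r \<mu> = 0"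
  and BPA_S_feasible: "2 \<le> card J \<Longrightarrow> feasible C J r \<mu> \<noteq> {} \<Longrightarrow>
    BPA_S J r \<mu> = (SUP x \<in> feasible C J r \<mu>. MIN e \<in> J. BPA_link e (x e) + BPA_S (J - {e}) x \<mu>)"
  unfolding BPA_S_def by (subst BPA_rec.simps, simp)+

definition BPA_argmax :: "'e set \<Rightarrow> ('e \<Rightarrow> real) \<Rightarrow> real \<Rightarrow> ('e \<Rightarrow> real) set" where
  "BPA_argmax J r \<mu> =
     {x. is_arg_max (\<lambda>x. MIN e \<in> J. BPA_link e (x e) + BPA_S (J - {e}) x \<mu>)
                    (\<lambda>x. x \<in> feasible C J r \<mu>) x}"

definition BPA_routing :: "'e routing \<Rightarrow> bool" where
  "BPA_routing P \<longleftrightarrow> routing_policy P \<and>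
     (\<forall>v \<in> verts G - {n}. \<forall>\<mu> \<ge> 0.
        (feasible C (out_arcs G v) (\<lambda>_. 0) \<mu> \<noteq> {} \<longrightarrow>
           P v (out_arcs G v) \<mu> \<in> BPA_argmax (out_arcs G v) (\<lambda>_. 0) \<mu>) \<and>
        (\<forall>J. J \<noteq> {} \<and> J \<subset> out_arcs G v \<longrightarrow>
           feasible C J (P v (out_arcs G v) \<mu>) \<mu> \<noteq> {} \<longrightarrow>
           P v J \<mu> \<in> BPA_argmax J (P v (out_arcs G v) \<mu>) \<mu>))"

definition BPA_value :: "real \<Rightarrow> real" where
  "BPA_value lam = BPA_S (out_arcs G 0) (\<lambda>_. 0) lam"

end

end

theory Submission
  imports Defs
begin

text \<open>
  In the tree, a node has a single incoming link, so the part of the disturbance needed to remove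
  it lies in the subtree below it. By flow and link monotonicity, the flow on a link \<open>e\<close> of
  \<open>v\<close> is at most \<open>P v K \<mu> e\<close> as long as the links of \<open>K \<ni> e\<close> are active and the inflow of \<open>v\<close> has
  not exceeded \<open>\<mu>\<close>. If \<open>e\<close> is the first of them to fail, this consumes at least
  \<open>S\<^sub>e\<close> of this value in its own branch, either on the link or, by induction, in the subtree of its head. Letting the outgoing links of \<open>v\<close>
  fail one after the other, the removal of \<open>v\<close> consumes at least \<open>R\<^sub>v(\<mu>)\<close>; with at most three
  links, the optima in the recursion for \<open>R\<^sub>v\<close> are exactly those attained by the policy. So the
  origin is never removed. As the active nodes and links only decrease, the flows settle, and
  then conservation at the active nodes forces the outflow \<open>\<lambda>\<close>.
\<close>

section \<open>Decreasing sets, and undirected paths and cycles\<close>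

lemma eventually_constant_if_antimono:
  fixes A :: "nat \<Rightarrow> 'a set"
  assumes anti: "\<And>s t. s \<le> t \<Longrightarrow> A t \<subseteq> A s" and fin: "finite (A 0)"
  obtains T where "\<And>t. T \<le> t \<Longrightarrow> A t = A T"
proof -
  obtain T where T: "\<And>t. card (A T) \<le> card (A t)"
    using ex_has_least_nat [of "\<lambda>_. True" 0 "\<lambda>t. card (A t)"] by auto
  have "A t = A T" if "T \<le> t" for t
    using anti [OF that] T finite_subset [OF anti fin] by (intro card_seteq) auto
  then show thesis by (rule that)
qed

definition joined :: "('v, 'e) pre_digraph \<Rightarrow> 'e set \<Rightarrow> ('v \<times> 'v) set" where
  "joined G A = {(u, v). \<exists>e\<in>A. {tail G e, head G e} = {u, v}}"

lemma sym_joined: "sym (joined G A)"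
  by (auto simp: joined_def sym_def insert_commute)

text \<open>Each further arc either reaches a new node or returns to an old one; in the second case
  the path is cut back to that node. Distinctness of the arcs is left out here, since it follows
  from that of the nodes.\<close>

lemma joined_undirected_path:
  assumes "(a, b) \<in> (joined G A)\<^sup>*"
  shows "\<exists>vs es. length vs = Suc (length es) \<and> distinct vs \<and> vs ! 0 = a \<and> vs ! length es = b \<and>
    set es \<subseteq> A \<and> (\<forall>i < length es. {tail G (es ! i), head G (es ! i)} = {vs ! i, vs ! Suc i})"
  using assms
proof (induction rule: rtrancl_induct)
  case base
  show ?case by (rule exI [of _ "[a]"], rule exI [of _ "[]"]) simp
next
  case (step b c)
  then obtain vs es e where
    vs: "length vs = Suc (length es)" "distinct vs" "vs ! 0 = a" "vs ! length es = b"
    and es: "set es \<subseteq> A"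
      "\<forall>i < length es. {tail G (es ! i), head G (es ! i)} = {vs ! i, vs ! Suc i}"
    and e: "e \<in> A" "{tail G e, head G e} = {b, c}"
    unfolding joined_def by blast
  show ?case
  proof (cases "c \<in> set vs")
    case True
    then obtain k where k: "k < length vs" "vs ! k = c" by (auto simp: in_set_conv_nth)
    show ?thesis
      by (rule exI [of _ "take (Suc k) vs"], rule exI [of _ "take k es"])
        (use vs es k in \<open>auto dest: in_set_takeD\<close>)
  next
    case False
    show ?thesis
      by (rule exI [of _ "vs @ [c]"], rule exI [of _ "es @ [e]"])
        (use vs es e False in \<open>auto simp: nth_append less_Suc_eq\<close>)
  qed
qed

text \<open>If the ends of \<open>e\<close> stay connected after deleting \<open>e\<close>, a path
  between them is closed up by \<open>e\<close> itself.\<close>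

lemma undirected_cycle_if_joined:
  assumes wf: "wf_digraph G"
    and e: "e \<in> arcs G" "{tail G e, head G e} = {a, b}" "a \<noteq> b"
    and ab: "(a, b) \<in> (joined G (arcs G - {e}))\<^sup>*"
  shows "\<exists>vs es. undirected_cycle G vs es"
proof -
  interpret wf_digraph G by (rule wf)
  obtain vs es where
    vs: "length vs = Suc (length es)" "distinct vs" "vs ! 0 = a" "vs ! length es = b"
    and es: "set es \<subseteq> arcs G - {e}"
      "\<And>i. i < length es \<Longrightarrow> {tail G (es ! i), head G (es ! i)} = {vs ! i, vs ! Suc i}"
    using joined_undirected_path [OF ab] by blast
  \<comment> \<open>Equal arcs at \<open>i\<close> and \<open>j\<close> have the same pair of ends,
    which for distinct nodes forces both \<open>i = Suc j\<close> and
    \<open>Suc i = j\<close>.\<close>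
  have "distinct es"
    unfolding distinct_conv_nth
  proof (intro allI impI notI)
    fix i j assume ij: "i < length es" "j < length es" "i \<noteq> j" "es ! i = es ! j"
    then have "{vs ! i, vs ! Suc i} = {vs ! j, vs ! Suc j}" using es(2) by metis
    moreover have "vs ! i \<noteq> vs ! j" using ij vs by (simp add: nth_eq_iff_index_eq)
    ultimately have "vs ! i = vs ! Suc j" "vs ! Suc i = vs ! j" by (auto simp: doubleton_eq_iff)
    then have "i = Suc j" "Suc i = j" using ij vs by (auto simp: nth_eq_iff_index_eq)
    then show False by simp
  qed
  moreover have "set vs \<subseteq> verts G"
  proof
    fix u assume "u \<in> set vs"
    then obtain i where i: "i < length vs" "u = vs ! i" by (auto simp: in_set_conv_nth)
    show "u \<in> verts G"
    proof (cases "i < length es")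
      case True
      then have "es ! i \<in> arcs G" using es(1) by (meson DiffD1 nth_mem subsetD)
      moreover have "u \<in> {tail G (es ! i), head G (es ! i)}" using es(2) [OF True] i by simp
      ultimately show ?thesis by auto
    next
      case False
      then have "u = b" using i vs by (metis less_SucE)
      then have "u \<in> {tail G e, head G e}" using e by simp
      then show ?thesis using e(1) by auto
    qed
  qed
  moreover have "{tail G ((es @ [e]) ! i), head G ((es @ [e]) ! i)}
      = {vs ! i, vs ! (Suc i mod length vs)}" if "i < length (es @ [e])" for i
  proof (cases "i < length es")
    case True
    then show ?thesis using es(2) [of i] vs by (simp add: nth_append)
  next
    \<comment> \<open>This is the closing arc \<open>e\<close>: at the last index,
      \<open>Suc i mod length vs\<close> is 0.\<close>
    case False
    then have "i = length es" using that by simp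
    then show ?thesis using vs e by (simp add: insert_commute)
  qed
  ultimately have "undirected_cycle G vs (es @ [e])"
    using vs es e unfolding undirected_cycle_def by auto
  then show ?thesis by blast
qed

section \<open>The tree below the origin, and the recursion at a single node\<close>

context acyclic_network
begin

lemma head_le: "e \<in> arcs G \<Longrightarrow> head G e \<le> n"
  using head_in_verts nodes by auto

lemma tail_less: "e \<in> arcs G \<Longrightarrow> tail G e < n"
  using topological [of e] head_le [of e] by linarith

text \<open>
  Climbing from the tail of \<open>e1\<close> to the origin and descending again to \<open>v\<close> through \<open>e2\<close> avoids
  \<open>e1\<close>, because all links on this way except \<open>e2\<close> have heads below \<open>v\<close>. Hence \<open>e1\<close> closes a cycle.
\<close>

lemma tree_unique_in_arc:
  assumes tree: "directed_tree without_destination"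
    and v: "v \<noteq> n" and e1: "e1 \<in> in_arcs G v" and e2: "e2 \<in> in_arcs G v"
  shows "e1 = e2"
proof (rule ccontr)
  assume ne: "e1 \<noteq> e2"
  let ?H = "without_destination"
  have [simp]: "tail ?H = tail G" "head ?H = head G" "verts ?H = verts G - {n}"
    "arcs ?H = arcs G - in_arcs G n"
    by (simp_all add: without_destination_def)
  have wf: "wf_digraph ?H"
  proof
    fix e assume "e \<in> arcs ?H"
    then show "tail ?H e \<in> verts ?H" "head ?H e \<in> verts ?H"
      using tail_less [of e] by auto
  qed
  have vn: "v < n" using e1 v head_le [of e1] by auto
  define R where "R = joined ?H (arcs ?H - {e1})"
  have symR: "sym (R\<^sup>*)" unfolding R_def by (intro sym_rtrancl sym_joined)
  have origin: "(0, u) \<in> R\<^sup>*" if "u < v" for u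
    using that
  proof (induction u rule: less_induct)
    case (less u)
    show ?case
    proof (cases "u = 0")
      case False
      have "u \<in> verts G" using less vn nodes by auto
      then have "in_arcs G u \<noteq> {}" using unique_origin [of u] False by blast
      then obtain e where "e \<in> in_arcs G u" by blast
      then have e: "e \<in> arcs G" "head G e = u" by auto
      then have "(0, tail G e) \<in> R\<^sup>*" using less topological [of e] by auto
      moreover have "(tail G e, u) \<in> R"
        unfolding R_def joined_def using e less vn e1 by auto
      ultimately show ?thesis by (rule rtrancl_into_rtrancl)
    qed simp
  qed
  have "(0, tail G e1) \<in> R\<^sup>*" "(0, tail G e2) \<in> R\<^sup>*"
    using origin e1 e2 topological [of e1] topological [of e2] by auto
  moreover have "(tail G e2, v) \<in> R"
    unfolding R_def joined_def using e2 v ne by auto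
  ultimately have "(tail G e1, v) \<in> R\<^sup>*"
    using symD [OF symR] by (meson rtrancl_trans rtrancl_into_rtrancl)
  moreover have "tail G e1 \<noteq> v" using topological [of e1] e1 by auto
  ultimately have "\<exists>vs es. undirected_cycle ?H vs es"
    using e1 v unfolding R_def by (intro undirected_cycle_if_joined [OF wf, of e1]) auto
  with tree show False by (auto simp: directed_tree_def)
qed

text \<open>A link is counted once for every directed walk from \<open>v\<close> to its tail. If all
  nodes except \<open>n\<close> have at most one incoming link, such a walk is unique, and this is
  the sum of \<open>d\<close> over the links of the subtree.\<close>

function subtree_cost :: "('e \<Rightarrow> real) \<Rightarrow> nat \<Rightarrow> real" where
  "subtree_cost d v = (\<Sum>e\<in>out_arcs G v. d e + subtree_cost d (head G e))"
  by pat_completeness auto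
termination
proof (relation "Wellfounded.measure (\<lambda>(d, v). n - v)")
  fix v e
  assume "e \<in> out_arcs G v"
  then show "((d, head G e), (d, v)) \<in> Wellfounded.measure (\<lambda>(d, v). n - v)" for d :: "'e \<Rightarrow> real"
    using topological [of e] head_le [of e] by auto
qed auto

declare subtree_cost.simps [simp del]

lemma subtree_cost_mono:
  "(\<And>e. e \<in> arcs G \<Longrightarrow> d e \<le> d' e) \<Longrightarrow> subtree_cost d v \<le> subtree_cost d' v"
proof (induction d v rule: subtree_cost.induct)
  case (1 d v)
  then show ?case
    unfolding subtree_cost.simps [of _ v] by (intro sum_mono add_mono) auto
qed

lemma subtree_cost_nonneg:
  "(\<And>e. e \<in> arcs G \<Longrightarrow> 0 \<le> d e) \<Longrightarrow> 0 \<le> subtree_cost d v"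
proof (induction d v rule: subtree_cost.induct)
  case (1 d v)
  then show ?case
    unfolding subtree_cost.simps [of _ v] by (intro sum_nonneg add_nonneg_nonneg) auto
qed

text \<open>
  Summing the recursion over all nodes, the cost of every node except the origin occurs once on
  the right as the cost of the head of its only incoming link, and cancels.
\<close>

lemma subtree_cost_origin:
  assumes uniq: "\<And>v e1 e2. v \<noteq> n \<Longrightarrow> e1 \<in> in_arcs G v \<Longrightarrow> e2 \<in> in_arcs G v \<Longrightarrow> e1 = e2"
  shows "subtree_cost d 0 = sum d (arcs G)"
proof -
  let ?B = "subtree_cost d"
  have fin: "finite (verts G)" "finite (arcs G)" by simp_all
  have out: "{e \<in> arcs G. tail G e = v} = out_arcs G v"
    and into: "{e \<in> arcs G. head G e = v} = in_arcs G v" for v by auto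
  \<comment> \<open>The destination may have many incoming links, but its cost is 0, so they do not
    disturb the cancellation.\<close>
  have Bn: "?B n = 0"
  proof -
    have "out_arcs G n = {}" using unique_destination [of n] nodes by simp
    then show ?thesis by (subst subtree_cost.simps) simp
  qed
  have "(\<Sum>v\<in>verts G. ?B v) = (\<Sum>v\<in>verts G. \<Sum>e\<in>{e \<in> arcs G. tail G e = v}. d e + ?B (head G e))"
    unfolding out by (intro sum.cong refl subtree_cost.simps)
  also have "\<dots> = (\<Sum>e\<in>arcs G. d e + ?B (head G e))"
    by (rule sum.group) (use fin in auto)
  also have "\<dots> = sum d (arcs G) + (\<Sum>e\<in>arcs G. ?B (head G e))"
    by (rule sum.distrib)
  also have "(\<Sum>e\<in>arcs G. ?B (head G e)) =
      (\<Sum>v\<in>verts G. \<Sum>e\<in>{e \<in> arcs G. head G e = v}. ?B (head G e))"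
    by (rule sum.group [symmetric]) (use fin in auto)
  also have "\<dots> = (\<Sum>v\<in>verts G. if v = 0 then 0 else ?B v)"
  proof (rule sum.cong [OF refl])
    fix v assume v: "v \<in> verts G"
    have "(\<Sum>e\<in>in_arcs G v. ?B (head G e)) = (\<Sum>e\<in>in_arcs G v. ?B v)" by (rule sum.cong) auto
    moreover have "is_singleton (in_arcs G v)" if "v \<noteq> 0" "v \<noteq> n"
      using uniq [of v] unique_origin [OF v] that by (auto intro!: is_singletonI')
    then have "card (in_arcs G v) = 1" if "v \<noteq> 0" "v \<noteq> n"
      using that by (simp add: is_singleton_altdef)
    moreover have "in_arcs G v = {}" if "v = 0" using unique_origin [OF v] that by simp
    ultimately show "(\<Sum>e\<in>{e \<in> arcs G. head G e = v}. ?B (head G e)) = (if v = 0 then 0 else ?B v)"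
      unfolding into using Bn by (cases "v = n") auto
  qed
  finally have "(\<Sum>v\<in>verts G. ?B v) - (\<Sum>v\<in>verts G. if v = 0 then 0 else ?B v) = sum d (arcs G)"
    by simp
  moreover have "(\<Sum>v\<in>verts G. ?B v) - (\<Sum>v\<in>verts G. if v = 0 then 0 else ?B v)
      = (\<Sum>v\<in>verts G. if v = 0 then ?B v else 0)"
    unfolding sum_subtractf [symmetric] by (rule sum.cong) auto
  moreover have "\<dots> = ?B 0" using nodes fin by (simp add: sum.delta')
  ultimately show ?thesis by simp
qed

text \<open>A maximizer attains the supremum, and the minimum over \<open>J\<close> is at most the
  term of any given \<open>e\<close>. Hence the recursion can be unfolded along whichever link fails
  first.\<close>

lemma BPA_S_argmax_le:
  assumes J: "2 \<le> card J" and x: "x \<in> BPA_argmax J r \<mu>" and e: "e \<in> J"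
  shows "BPA_S J r \<mu> \<le> BPA_link e (x e) + BPA_S (J - {e}) x \<mu>"
proof -
  let ?val = "\<lambda>x. MIN e \<in> J. BPA_link e (x e) + BPA_S (J - {e}) x \<mu>"
  have fin: "finite J" using J by (metis card.infinite not_numeral_le_zero)
  have xf: "x \<in> feasible C J r \<mu>" and max: "\<And>y. y \<in> feasible C J r \<mu> \<Longrightarrow> ?val y \<le> ?val x"
    using x by (auto simp: BPA_argmax_def is_arg_max_linorder)
  have "BPA_S J r \<mu> = (SUP x \<in> feasible C J r \<mu>. ?val x)"
    using BPA_S_feasible [OF J] xf by blast
  also have "\<dots> \<le> ?val x" using xf max by (intro cSUP_least) auto
  also have "\<dots> \<le> BPA_link e (x e) + BPA_S (J - {e}) x \<mu>" using fin e by (intro Min_le) auto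
  finally show ?thesis .
qed

text \<open>
  The links of one node fail in the order given by \<open>level\<close>; links of the same level fail together
  and may be taken one after the other.
\<close>

lemma BPA_S_le_cost:
  assumes P: "BPA_routing P" and v: "v \<in> verts G - {n}" and \<mu>: "0 \<le> \<mu>"
    and card: "card (out_arcs G v) \<le> 3"
    and c0: "\<And>e. e \<in> out_arcs G v \<Longrightarrow> 0 \<le> c e"
    and c: "\<And>e K. e \<in> K \<Longrightarrow> K \<subseteq> out_arcs G v \<Longrightarrow> \<forall>e'\<in>K. level e \<le> (level e' :: nat) \<Longrightarrow>
      BPA_link e (P v K \<mu> e) \<le> c e"
  shows "BPA_S (out_arcs G v) (\<lambda>_. 0) \<mu> \<le> sum c (out_arcs G v)"
proof -
  let ?E = "out_arcs G v"
  have fin: "finite ?E" by (rule finite_out_arcs)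
  have sumP: "sum (P v J \<mu>) J = \<mu>" if "J \<noteq> {}" "J \<subseteq> ?E" for J
    using P v that \<mu> unfolding BPA_routing_def routing_policy_def by blast
  \<comment> \<open>A single remaining link has to carry all of \<open>\<mu>\<close>, so its policy
    value is the argument at which the recursion ends.\<close>
  have single: "BPA_S J r \<mu> \<le> sum c J" if J: "card J = 1" "J \<subseteq> ?E" for J r
  proof -
    from J obtain e where e: "J = {e}" by (auto simp: card_1_singleton_iff)
    then show ?thesis using c [of e J] J sumP [of J] by (simp add: BPA_S_singleton)
  qed
  have step: "BPA_S J r \<mu> \<le> sum c J"
    if J: "2 \<le> card J" "J \<subseteq> ?E"
      and arg: "feasible C J r \<mu> \<noteq> {} \<Longrightarrow> P v J \<mu> \<in> BPA_argmax J r \<mu>"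
      and rest: "\<And>e. e \<in> J \<Longrightarrow> BPA_S (J - {e}) (P v J \<mu>) \<mu> \<le> sum c (J - {e})" for J r
  proof (cases "feasible C J r \<mu> = {}")
    case True
    then show ?thesis using J c0 by (subst BPA_S_infeasible) (auto intro!: sum_nonneg)
  next
    case False
    have finJ: "finite J" and "J \<noteq> {}" using J fin by (auto intro: finite_subset)
    then obtain e where e: "e \<in> J" "\<forall>e'\<in>J. level e \<le> level e'"
      using ex_is_arg_min_if_finite [of J level] by (auto simp: is_arg_min_linorder)
    have "BPA_S J r \<mu> \<le> BPA_link e (P v J \<mu> e) + BPA_S (J - {e}) (P v J \<mu>) \<mu>"
      using BPA_S_argmax_le J arg False e by blast
    also have "\<dots> \<le> c e + sum c (J - {e})" using c [of e J] e J rest by (intro add_mono) auto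
    also have "\<dots> = sum c J" using finJ e by (simp add: sum.remove)
    finally show ?thesis .
  qed
  \<comment> \<open>Removing one link of a pair leaves a singleton, where the recursion ignores the
    lower bounds.\<close>
  have pair: "BPA_S J r \<mu> \<le> sum c J"
    if J: "card J = 2" "J \<subseteq> ?E"
      and arg: "feasible C J r \<mu> \<noteq> {} \<Longrightarrow> P v J \<mu> \<in> BPA_argmax J r \<mu>" for J r
  proof (rule step)
    show "BPA_S (J - {e}) (P v J \<mu>) \<mu> \<le> sum c (J - {e})" if "e \<in> J" for e
      using J that finite_subset [OF J(2) fin] by (intro single) auto
  qed (use J arg in auto)
  have full: "feasible C ?E (\<lambda>_. 0) \<mu> \<noteq> {} \<Longrightarrow> P v ?E \<mu> \<in> BPA_argmax ?E (\<lambda>_. 0) \<mu>"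
    and part: "\<And>J. J \<noteq> {} \<Longrightarrow> J \<subset> ?E \<Longrightarrow> feasible C J (P v ?E \<mu>) \<mu> \<noteq> {} \<Longrightarrow>
      P v J \<mu> \<in> BPA_argmax J (P v ?E \<mu>) \<mu>"
  proof -
    note * = P [unfolded BPA_routing_def, THEN conjunct2, THEN bspec, OF v,
        THEN spec, THEN mp, OF \<mu>]
    show "P v ?E \<mu> \<in> BPA_argmax ?E (\<lambda>_. 0) \<mu>" if "feasible C ?E (\<lambda>_. 0) \<mu> \<noteq> {}"
      by (rule * [THEN conjunct1, THEN mp, OF that])
    show "P v J \<mu> \<in> BPA_argmax J (P v ?E \<mu>) \<mu>"
      if "J \<noteq> {}" "J \<subset> ?E" "feasible C J (P v ?E \<mu>) \<mu> \<noteq> {}" for J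
      by (rule * [THEN conjunct2, THEN spec, THEN mp, THEN mp, OF conjI [OF that(1,2)] that(3)])
  qed
  have "?E \<noteq> {}" using unique_destination [of v] v by auto
  then have "card ?E \<noteq> 0" using fin by simp
  then consider "card ?E = 1" | "card ?E = 2" | "card ?E = 3" using card by linarith
  then show ?thesis
  proof cases
    case 1
    then show ?thesis by (intro single) auto
  next
    case 2
    then show ?thesis using full by (intro pair) auto
  next
    \<comment> \<open>The pairs left after one removal have lower bounds
      \<open>P v ?E \<mu>\<close>, exactly those for which the policy on proper subsets is a
      maximizer. With four links, the recursion would reach pairs with the bounds of a triple
      instead.\<close>
    case 3
    show ?thesis
    proof (rule step)
      fix e assume e: "e \<in> ?E"
      then have two: "card (?E - {e}) = 2" using 3 by simp
      then have "?E - {e} \<noteq> {}" by (metis card.empty zero_neq_numeral)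
      then show "BPA_S (?E - {e}) (P v ?E \<mu>) \<mu> \<le> sum c (?E - {e})"
        using e by (intro pair [OF two] part psubsetI) blast+
    qed (use 3 full in auto)
  qed
qed

end

section \<open>The dynamics on the tree and bounds on its flows\<close>

locale bpa_tree_flow = acyclic_network G n C
  for G :: "(nat, 'e) pre_digraph" and n :: nat and C :: "'e \<Rightarrow> real" +
  fixes lam :: real and P :: "'e routing" and f0 :: "'e \<Rightarrow> real" and \<delta> :: "nat \<Rightarrow> 'e \<Rightarrow> real"
  assumes out_card: "\<forall>v \<in> verts G - {n}. card (out_arcs G v) \<le> 3"
    and tree: "directed_tree without_destination"
    and lam_pos: "0 < lam"
    and BPA: "BPA_routing P"
    and mono: "flow_monotone P"
    and equilibrium: "equilibrium_flow lam f0"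
    and consistent: "consistent_flow P lam f0"
    and disturbance: "disturbance \<delta>"
    and small: "magnitude \<delta> < BPA_value lam"
begin

abbreviation "state t \<equiv> net_dynamics P lam f0 \<delta> t"
abbreviation "links t \<equiv> act_links (state t)"
abbreviation "live t \<equiv> act_nodes (state t)"
abbreviation "flows t \<equiv> flow (state t)"
abbreviation "inflow t v \<equiv> node_inflow lam (links t) (flows t) v"
abbreviation "damage t e \<equiv> (\<Sum>s = 1..t. \<delta> s e)"

lemma links_Suc: "links (Suc t) =
    links t - {e \<in> links t. resid (state t) e \<le> flows t e} - {e \<in> links t. head G e \<notin> live t \<union> {n}}"
  and live_Suc: "live (Suc t) = live t - {v \<in> live t. out_arcs G v \<inter> links t = {}}"
  and flows_Suc: "flows (Suc t) e = (if tail G e \<in> live t \<and> e \<in> links t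
     then P (tail G e) (out_arcs G (tail G e) \<inter> links t) (inflow t (tail G e)) e else 0)"
  by (simp_all add: Let_def)

lemma state_0: "links 0 = arcs G" "live 0 = verts G - {n}" "flows 0 = f0"
  by simp_all

declare net_dynamics.simps [simp del]

lemma resid_eq: "resid (state t) e = C e - damage t e"
  by (induction t) (simp_all add: net_dynamics.simps Let_def)

lemma links_antimono: "s \<le> t \<Longrightarrow> links t \<subseteq> links s"
  by (rule lift_Suc_antimono_le [of links]) (auto simp: links_Suc)

lemma live_antimono: "s \<le> t \<Longrightarrow> live t \<subseteq> live s"
  by (rule lift_Suc_antimono_le [of live]) (auto simp: live_Suc)

lemma links_arcs: "links t \<subseteq> arcs G"
  using links_antimono [of 0 t] by (simp add: state_0)

lemma live_verts: "live t \<subseteq> verts G - {n}"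
  using live_antimono [of 0 t] by (simp add: state_0)

lemma policy:
  assumes "v \<in> verts G - {n}" "J \<noteq> {}" "J \<subseteq> out_arcs G v" "0 \<le> \<mu>"
  shows "\<And>e. e \<in> J \<Longrightarrow> 0 \<le> P v J \<mu> e" "sum (P v J \<mu>) J = \<mu>"
    "\<And>K e. K \<subseteq> J \<Longrightarrow> e \<in> K \<Longrightarrow> P v J \<mu> e \<le> P v K \<mu> e"
proof -
  have "(\<forall>e \<in> J. 0 \<le> P v J \<mu> e) \<and> (\<Sum>e\<in>J. P v J \<mu> e) = \<mu> \<and>
      (\<forall>K. K \<noteq> {} \<and> K \<subseteq> J \<longrightarrow> (\<forall>e \<in> K. P v J \<mu> e \<le> P v K \<mu> e))"
  proof -
    have "routing_policy P" using BPA by (simp add: BPA_routing_def)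
    note this [unfolded routing_policy_def, THEN bspec, OF assms(1), THEN spec, THEN mp]
    then show ?thesis using assms by simp
  qed
  then show "\<And>e. e \<in> J \<Longrightarrow> 0 \<le> P v J \<mu> e" "sum (P v J \<mu>) J = \<mu>"
    "\<And>K e. K \<subseteq> J \<Longrightarrow> e \<in> K \<Longrightarrow> P v J \<mu> e \<le> P v K \<mu> e" by blast+
qed

lemma tail_node: "e \<in> arcs G \<Longrightarrow> tail G e \<in> verts G - {n}"
  using tail_less [of e] by auto

lemma flows_nonneg: "e \<in> arcs G \<Longrightarrow> 0 \<le> flows t e"
  and inflow_nonneg: "0 \<le> inflow t v"
proof -
  have inflow: "0 \<le> inflow t v" if "\<And>e. e \<in> arcs G \<Longrightarrow> 0 \<le> flows t e" for t v
    unfolding node_inflow_def using lam_pos that by (auto intro!: add_nonneg_nonneg sum_nonneg)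
  have *: "\<And>e. e \<in> arcs G \<Longrightarrow> 0 \<le> flows t e" for t
  proof (induction t)
    case 0
    then show ?case using equilibrium by (auto simp: state_0 equilibrium_flow_def)
  next
    case (Suc t)
    then show ?case
      unfolding flows_Suc using inflow [OF Suc.IH] tail_node [of e]
      by (auto intro!: policy(1))
  qed
  show "e \<in> arcs G \<Longrightarrow> 0 \<le> flows t e" by (rule *)
  show "0 \<le> inflow t v" by (rule inflow [OF *])
qed

lemma unique_in_arc: "v \<noteq> n \<Longrightarrow> e1 \<in> in_arcs G v \<Longrightarrow> e2 \<in> in_arcs G v \<Longrightarrow> e1 = e2"
  using tree_unique_in_arc [OF tree] .

lemma inflow_origin: "inflow t 0 = lam"
proof -
  have "in_arcs G 0 = {}" using unique_origin [of 0] nodes by simp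
  then show ?thesis by (simp add: node_inflow_def)
qed

text \<open>The tree structure enters the dynamics here: the only incoming link of a node feeds it
  alone, so a bound on the flow of that link bounds the inflow.\<close>

lemma inflow_head:
  assumes "e \<in> links t" "head G e \<noteq> n"
  shows "inflow t (head G e) = flows t e"
proof -
  have e: "e \<in> arcs G" using assms links_arcs by blast
  then have "in_arcs G (head G e) \<inter> links t = {e}"
    using assms unique_in_arc [OF assms(2)] by auto
  moreover have "head G e \<noteq> 0" using topological [OF e] by simp
  ultimately show ?thesis by (simp add: node_inflow_def)
qed

text \<open>Link monotonicity shrinks the set of active links to \<open>K\<close>, then flow
  monotonicity raises the inflow to \<open>\<mu>\<close>. Flow monotonicity is not assumed at the
  origin, but there the inflow is constantly \<open>lam\<close>.\<close>

lemma flows_le: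
  assumes v: "v \<in> verts G - {n}" and K: "e \<in> K" "K \<subseteq> out_arcs G v \<inter> links t"
    and \<mu>: "\<And>s. s \<le> t \<Longrightarrow> inflow s v \<le> \<mu>" and origin: "v = 0 \<Longrightarrow> \<mu> = lam"
  shows "flows t e \<le> P v K \<mu> e"
proof -
  have bound: "P v J (inflow s v) e \<le> P v K \<mu> e"
    if s: "s \<le> t" and J: "K \<subseteq> J" "J \<subseteq> out_arcs G v" for s J
  proof -
    have "P v J (inflow s v) e \<le> P v K (inflow s v) e"
      using policy(3) [OF v _ J(2) inflow_nonneg] J K by blast
    also have "\<dots> \<le> P v K \<mu> e"
    proof (cases "v = 0")
      case True
      then show ?thesis using inflow_origin origin by simp
    next
      case False
      then have "flow_monotone_at P v" using mono v by (auto simp: flow_monotone_def)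
      note this [unfolded flow_monotone_at_def, THEN spec, THEN mp, THEN spec, THEN spec, THEN mp]
      moreover have "K \<noteq> {} \<and> K \<subseteq> out_arcs G v" using K by auto
      ultimately show ?thesis using K(1) inflow_nonneg \<mu> [OF s] by simp
    qed
    finally show ?thesis .
  qed
  \<comment> \<open>The flow at time \<open>t\<close> was routed with the links and the inflow of
    time \<open>t - 1\<close>; at time 0, consistency of \<open>f0\<close> replaces this.\<close>
  show ?thesis
  proof (cases t)
    case 0
    have "f0 e = P v (out_arcs G v) (inflow 0 v) e"
      using consistent v K by (auto simp: consistent_flow_def state_0)
    then show ?thesis using bound [of 0 "out_arcs G v"] K by (auto simp: 0 state_0)
  next
    case (Suc s)
    have e: "tail G e = v" using K by auto
    \<comment> \<open>This settles the case that \<open>v\<close> was already removed at time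
      \<open>s\<close>, where the flow is set to 0.\<close>
    have "0 \<le> P v K \<mu> e"
      using K \<mu> [of 0] inflow_nonneg [of 0 v] by (intro policy(1) [OF v]) auto
    moreover have "P v (out_arcs G v \<inter> links s) (inflow s v) e \<le> P v K \<mu> e"
      using bound [of s "out_arcs G v \<inter> links s"] K Suc links_antimono [of s t] by auto
    ultimately show ?thesis by (simp add: Suc flows_Suc e)
  qed
qed

section \<open>Failures and the damage they require\<close>

lemma not_live_imp:
  "v \<in> verts G - {n} \<Longrightarrow> v \<notin> live t \<Longrightarrow> \<exists>s<t. out_arcs G v \<inter> links s = {}"
  by (induction t) (auto simp: state_0 live_Suc less_Suc_eq)

lemma not_link_imp:
  "e \<in> arcs G \<Longrightarrow> e \<notin> links t \<Longrightarrow> \<exists>s<t. e \<in> links s \<and> e \<notin> links (Suc s)"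
  by (induction t) (auto simp: state_0 less_Suc_eq)

lemma damage_nonneg: "e \<in> arcs G \<Longrightarrow> 0 \<le> damage t e"
  using disturbance by (auto simp: disturbance_def intro!: sum_nonneg)

lemma damage_mono: "e \<in> arcs G \<Longrightarrow> s \<le> t \<Longrightarrow> damage s e \<le> damage t e"
  using disturbance by (intro sum_mono2) (auto simp: disturbance_def)

text \<open>By induction from the destination backwards. Each failure of a link is charged either to
  the damage on that link or to the subtree of its head, and \<open>BPA_S_le_cost\<close> combines
  the charges at \<open>v\<close>.\<close>

lemma node_failure_cost:
  assumes "v \<in> verts G - {n}" "out_arcs G v \<inter> links t = {}"
    and "\<And>s. s \<le> t \<Longrightarrow> inflow s v \<le> \<mu>" "v = 0 \<Longrightarrow> \<mu> = lam"
  shows "BPA_R v \<mu> \<le> subtree_cost (damage t) v"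
  using assms
proof (induction "n - v" arbitrary: v t \<mu> rule: less_induct)
  case less
  note v = less.prems(1)
  \<comment> \<open>The first time at which \<open>e\<close> is inactive. It exists for the outgoing
    links of \<open>v\<close>, as all of them are inactive at time \<open>t\<close>.\<close>
  let ?level = "\<lambda>e. LEAST s. e \<notin> links s"
  have \<mu>: "0 \<le> \<mu>" using less.prems(3) [of 0] inflow_nonneg [of 0 v] by simp
  have "BPA_S (out_arcs G v) (\<lambda>_. 0) \<mu>
      \<le> (\<Sum>e\<in>out_arcs G v. damage t e + subtree_cost (damage t) (head G e))"
  proof (rule BPA_S_le_cost [OF BPA v \<mu>, where level = ?level])
    show "card (out_arcs G v) \<le> 3" using out_card v by blast
    show "0 \<le> damage t e + subtree_cost (damage t) (head G e)" if "e \<in> out_arcs G v" for e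
      using that by (intro add_nonneg_nonneg subtree_cost_nonneg damage_nonneg) auto
    fix e K
    assume K: "e \<in> K" "K \<subseteq> out_arcs G v" and first: "\<forall>e'\<in>K. ?level e \<le> ?level e'"
    then have e: "e \<in> arcs G" "tail G e = v" by auto
    have "e \<notin> links t" using less.prems(2) K by auto
    \<comment> \<open>\<open>r\<close> is the last time at which \<open>e\<close> is active. The
      links of \<open>K\<close> fail no earlier, so all of \<open>K\<close> is active up to time
      \<open>r\<close>.\<close>
    then obtain r where r: "r < t" "e \<in> links r" "e \<notin> links (Suc r)"
      using not_link_imp e by blast
    have "r < ?level e"
    proof (rule ccontr)
      assume "\<not> r < ?level e"
      then have "e \<in> links (?level e)" using r(2) links_antimono by (meson not_less subsetD)
      then show False using LeastI [of "\<lambda>s. e \<notin> links s", OF r(3)] by simp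
    qed
    then have K_links: "K \<subseteq> links s" if "s \<le> r" for s
      using that first not_less_Least [of s "\<lambda>s. _ \<notin> links s"] by fastforce
    let ?x = "P v K \<mu> e"
    have flow_le: "flows s e \<le> ?x" if "s \<le> r" for s
      using that r less.prems(3,4) K K_links [OF that] by (intro flows_le [OF v]) auto
    have cost0: "0 \<le> damage t e" "0 \<le> subtree_cost (damage t) (head G e)"
      by (intro subtree_cost_nonneg damage_nonneg e)+
    have "resid (state r) e \<le> flows r e \<or> head G e \<notin> live r \<union> {n}"
      using r by (auto simp: links_Suc)
    then show "BPA_link e ?x \<le> damage t e + subtree_cost (damage t) (head G e)"
    proof
      \<comment> \<open>Overload: the damage on \<open>e\<close> has pushed its residual capacity
        down to a flow of at most \<open>?x\<close>.\<close>
      assume "resid (state r) e \<le> flows r e"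
      then have "C e - ?x \<le> damage t e"
        using flow_le [of r] damage_mono [of e r t] e r by (simp add: resid_eq)
      then show ?thesis using cost0 by (auto simp: BPA_link_def)
    next
      \<comment> \<open>The head has been removed, so its outgoing links were gone at some earlier
        \<open>s\<close>. Up to then only \<open>e\<close> fed it, with flow at most
        \<open>?x\<close>, and the induction hypothesis applies with \<open>?x\<close> as the bound
        on the inflow.\<close>
      assume w: "head G e \<notin> live r \<union> {n}"
      then obtain s where s: "s < r" "out_arcs G (head G e) \<inter> links s = {}"
        using not_live_imp [of "head G e" r] e by auto
      have "BPA_R (head G e) ?x \<le> subtree_cost (damage s) (head G e)"
      proof (rule less.hyps)
        show "n - head G e < n - v" using topological [of e] e tail_less [of e] by auto
        show "inflow u (head G e) \<le> ?x" if "u \<le> s" for u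
          using that s w K(1) K_links [of u] flow_le [of u] by (subst inflow_head) auto
        show "head G e = 0 \<Longrightarrow> ?x = lam" using topological [of e] e by simp
      qed (use s w e in auto)
      also have "\<dots> \<le> subtree_cost (damage t) (head G e)"
        using s r by (intro subtree_cost_mono damage_mono) auto
      finally show ?thesis using w cost0 by (auto simp: BPA_link_def)
    qed
  qed
  then show ?case by (simp add: BPA_R_eq subtree_cost.simps [of _ v])
qed

text \<open>On each link the partial sums are bounded by the capacity, so the series in
  \<open>magnitude\<close> converge and dominate them.\<close>

lemma damage_le_magnitude: "sum (damage t) (arcs G) \<le> magnitude \<delta>"
  unfolding magnitude_def
proof (rule sum_mono)
  fix e assume e: "e \<in> arcs G"
  have shift: "damage t e = (\<Sum>i<t. \<delta> (Suc i) e)" for t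
    by (simp add: sum.atLeast1_atMost_eq lessThan_atLeast0)
  have nonneg: "0 \<le> \<delta> (Suc i) e" for i using disturbance e by (simp add: disturbance_def)
  have "summable (\<lambda>i. \<delta> (Suc i) e)"
  proof (rule bounded_imp_summable [where B = "C e"])
    show "0 \<le> \<delta> (Suc i) e" for i by (rule nonneg)
    show "(\<Sum>i\<le>k. \<delta> (Suc i) e) \<le> C e" for k
      using disturbance e shift [of "Suc k"]
      unfolding disturbance_def lessThan_Suc_atMost by (metis le_add1 plus_1_eq_Suc)
  qed
  then show "damage t e \<le> (\<Sum>i. \<delta> (Suc i) e)"
    unfolding shift by (rule sum_le_suminf) (use nonneg in auto)
qed

section \<open>Survival of the origin and convergence of the flows\<close>

lemma origin_live: "0 < n" "0 \<in> live t"
proof -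
  \<comment> \<open>Without links at the origin \<open>BPA_value lam\<close> would be 0, which
    cannot exceed a nonnegative magnitude.\<close>
  have "magnitude \<delta> \<ge> 0"
    using damage_le_magnitude [of 0] by simp
  then have "out_arcs G 0 \<noteq> {}" using small by (auto simp: BPA_value_def BPA_S_empty)
  then show n: "0 < n" using tail_less by fastforce
  show "0 \<in> live t"
  proof (rule ccontr)
    assume "0 \<notin> live t"
    then obtain s where s: "out_arcs G 0 \<inter> links s = {}"
      using not_live_imp [of 0 t] nodes n by auto
    have "BPA_value lam \<le> subtree_cost (damage s) 0"
      using node_failure_cost [OF _ s, of lam] nodes n
      by (simp add: inflow_origin BPA_R_eq BPA_value_def)
    also have "\<dots> = sum (damage s) (arcs G)"
      using unique_in_arc by (rule subtree_cost_origin)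
    also have "\<dots> \<le> magnitude \<delta>" by (rule damage_le_magnitude)
    finally show False using small by simp
  qed
qed

lemma transferring_limit: "transferring P lam f0 \<delta>"
proof -
  obtain T1 where T1: "\<And>t. T1 \<le> t \<Longrightarrow> links t = links T1"
    using eventually_constant_if_antimono [of links] links_antimono by (auto simp: state_0)
  obtain T2 where T2: "\<And>t. T2 \<le> t \<Longrightarrow> live t = live T2"
    using eventually_constant_if_antimono [of live] live_antimono by (auto simp: state_0)
  define T where "T = max T1 T2"
  define L where "L = links T"
  define V where "V = live T"
  have L: "links t = L" and V: "live t = V" if "T \<le> t" for t
    using that T1 [of t] T1 [of T] T2 [of t] T2 [of T] by (simp_all add: T_def L_def V_def)
  have finL: "finite L" unfolding L_def by (rule finite_subset [OF links_arcs]) simp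
  have LA: "L \<subseteq> arcs G" unfolding L_def by (rule links_arcs)
  have VA: "V \<subseteq> verts G - {n}" unfolding V_def by (rule live_verts)
  have finV: "finite V" using finite_subset [OF VA] by simp
  \<comment> \<open>A violation of this or of \<open>outV\<close> would remove a link or a node in
    the next step, although both sets are constant from time \<open>T\<close> on.\<close>
  have headL: "head G e \<in> V \<union> {n}" if "e \<in> L" for e
    using that links_Suc [of T] L [of "Suc T"] L [of T] V [of T] by auto
  have outV: "out_arcs G v \<inter> L \<noteq> {}" if "v \<in> V" for v
    using that live_Suc [of T] V [of "Suc T"] L [of T] V [of T] by auto
  have flows_step: "flows (Suc t) e =
      (if tail G e \<in> V \<and> e \<in> L then P (tail G e) (out_arcs G (tail G e) \<inter> L)
         (node_inflow lam L (flows t) (tail G e)) e else 0)" if "T \<le> t" for t e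
    using that by (simp add: flows_Suc L V)
  \<comment> \<open>The flows settle along the topological order, one step per node number, since
    inflow comes from smaller nodes. The extra step is there because the flows at \<open>t\<close>
    and at \<open>Suc t\<close> both have to be routed with the final sets.\<close>
  have settled: "flows (Suc t) e = flows t e" if "e \<in> arcs G" "T + Suc (tail G e) \<le> t" for t e
    using that
  proof (induction "tail G e" arbitrary: e t rule: less_induct)
    case less
    obtain s where s: "t = Suc s" "T + tail G e \<le> s" using less.prems(2) by (cases t) auto
    have "node_inflow lam L (flows (Suc s)) (tail G e) = node_inflow lam L (flows s) (tail G e)"
      unfolding node_inflow_def
      using less topological s by (intro arg_cong2 [of _ _ _ _ "(+)"] sum.cong) fastforce+
    then show ?case using s by (simp add: flows_step)
  qed
  have limit: "(\<Sum>e\<in>in_arcs G n. flows (Suc t) e) = lam" if t: "T + Suc n \<le> t" for t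
  proof -
    let ?f = "flows (Suc t)"
    have f_eq: "flows t e = ?f e" if "e \<in> arcs G" for e
      using settled [OF that, of t] tail_less [OF that] t by simp
    have f0: "?f e = 0" if "tail G e \<notin> V \<or> e \<notin> L" for e
      using that t flows_step [of t e] by auto
    have conserve: "(\<Sum>e\<in>{e\<in>L. tail G e = v}. ?f e) =
        (if v = 0 then lam else 0) + (\<Sum>e\<in>{e\<in>L. head G e = v}. ?f e)" if v: "v \<in> V" for v
    proof -
      have inf: "node_inflow lam L (flows t) v = inflow t v" using L [of t] t by simp
      have sets: "{e\<in>L. tail G e = v} = out_arcs G v \<inter> L" "{e\<in>L. head G e = v} = in_arcs G v \<inter> L"
        using LA by auto
      have "(\<Sum>e\<in>out_arcs G v \<inter> L. ?f e) =
          (\<Sum>e\<in>out_arcs G v \<inter> L. P v (out_arcs G v \<inter> L) (inflow t v) e)"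
        using v t inf by (intro sum.cong) (auto simp: flows_step)
      also have "\<dots> = inflow t v"
        using v VA outV [OF v] inflow_nonneg by (intro policy(2)) auto
      also have "\<dots> = (if v = 0 then lam else 0) + (\<Sum>e\<in>in_arcs G v \<inter> L. ?f e)"
        unfolding inf [symmetric] node_inflow_def
        using L [of t] t by (intro arg_cong2 [of _ _ _ _ "(+)"] sum.cong) (auto simp: f_eq)
      finally show ?thesis unfolding sets .
    qed
    \<comment> \<open>The total flow on \<open>L\<close> is computed twice. Grouped by tails,
      conservation gives \<open>lam\<close> plus the flow into \<open>V\<close>; split by heads, it
      is the flow into \<open>n\<close> plus the flow into \<open>V\<close>.\<close>
    have "sum ?f L = sum ?f {e\<in>L. tail G e \<in> V}"
      using finL f0 by (intro sum.mono_neutral_right) auto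
    also have "\<dots> = (\<Sum>v\<in>V. \<Sum>e\<in>{e \<in> {e\<in>L. tail G e \<in> V}. tail G e = v}. ?f e)"
      by (rule sum.group [symmetric]) (use finL finV in auto)
    also have "\<dots> = (\<Sum>v\<in>V. \<Sum>e\<in>{e\<in>L. tail G e = v}. ?f e)"
      by (intro sum.cong) auto
    also have "\<dots> = (\<Sum>v\<in>V. if v = 0 then lam else 0) + (\<Sum>v\<in>V. \<Sum>e\<in>{e\<in>L. head G e = v}. ?f e)"
      by (simp add: conserve sum.distrib)
    also have "(\<Sum>v\<in>V. if v = 0 then lam else 0) = lam"
      using origin_live(2) [of T] finV by (simp add: V_def)
    also have "(\<Sum>v\<in>V. \<Sum>e\<in>{e\<in>L. head G e = v}. ?f e) =
        (\<Sum>v\<in>V. \<Sum>e\<in>{e \<in> {e\<in>L. head G e \<noteq> n}. head G e = v}. ?f e)"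
      using VA by (intro sum.cong) auto
    also have "\<dots> = sum ?f {e\<in>L. head G e \<noteq> n}"
      by (rule sum.group) (use finL finV headL in auto)
    finally have "sum ?f L = lam + sum ?f {e\<in>L. head G e \<noteq> n}" .
    moreover have "sum ?f L = sum ?f {e\<in>L. head G e = n} + sum ?f {e\<in>L. head G e \<noteq> n}"
      using finL by (subst sum.union_disjoint [symmetric]) (auto intro: sum.cong)
    moreover have "sum ?f (in_arcs G n) = sum ?f {e\<in>L. head G e = n}"
      using LA f0 by (intro sum.mono_neutral_right) auto
    ultimately show ?thesis by simp
  qed
  have "eventually (\<lambda>t. (\<Sum>e\<in>in_arcs G n. flows t e) = lam) sequentially"
    unfolding eventually_sequentially
  proof (intro exI [of _ "Suc (T + Suc n)"] allI impI)
    fix t assume "Suc (T + Suc n) \<le> t"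
    then show "(\<Sum>e\<in>in_arcs G n. flows t e) = lam" using limit [of "t - 1"] by (cases t) auto
  qed
  then show ?thesis unfolding transferring_def by (rule tendsto_eventually)
qed

end

theorem theorem2:
  fixes G :: "(nat, 'e) pre_digraph" and n :: nat and C :: "'e \<Rightarrow> real"
    and lam :: real and P :: "'e routing" and f0 :: "'e \<Rightarrow> real"
    and \<delta> :: "nat \<Rightarrow> 'e \<Rightarrow> real"
  assumes "acyclic_network G n C"
    and "\<forall>v \<in> verts G - {n}. card (out_arcs G v) \<le> 3"
    and "directed_tree (network.without_destination G n)"
    and "0 < lam"
    and "acyclic_network.BPA_routing G n C P"
    and "network.flow_monotone G n P"
    and "network.equilibrium_flow G n C lam f0"
    and "network.consistent_flow G n P lam f0"
    and "network.disturbance G C \<delta>"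
    and "network.magnitude G \<delta> < acyclic_network.BPA_value G n C lam"
  shows "network.transferring G n C P lam f0 \<delta>"
proof -
  interpret bpa_tree_flow G n C lam P f0 \<delta>
    using assms by (simp add: bpa_tree_flow_def bpa_tree_flow_axioms_def)
  show ?thesis by (rule transferring_limit)
qed

end
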